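(* Let $n$ be a positive integer. There exist $u,v\in\mathbb C^n\setminus\{0\}$ such that $$u_iv_i=0\quad\text{and}\quad \hat u_i\,\check v_i=0\qquad\text{for all } i\in\{0,1,\ldots,n-1\}$$ if and only if $n$ is composite. Moreover, for any divisor $d$ of $n$ that satisfies $1<d<\sqrt{2n}$, there exist $1+\lfloor d/2\rfloor$ vectors $u^{(0)},u^{(1)},\ldots,u^{(\lfloor d/2\rfloor)}\in\mathbb C^n\setminus\{0\}$ that mutually satisfy this condition, i.e., for all distinct $k,k'\in\{0,1,\ldots,\lfloor d/2\rfloor\}$, $$u^{(k)}_i u^{(k')}_i=0\quad\text{and}\quad \widehat{u^{(k)}}_i\cdot \big(u^{(k')}\big)^{\vee}_i=0\qquad\text{for all } i\in\{0,1,\ldots,n-1\}.$$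
   Context: Vectors in $\mathbb C^n$ are indexed by $\{0,1,\ldots,n-1\}$. Let $\zeta_n=e^{2\pi i/n}$ (here $i$ is the imaginary unit). For $x=(x_0,\ldots,x_{n-1})^T\in\mathbb C^n$, the Fourier transform $\hat x\in\mathbb C^n$ and the inverse Fourier transform $\check x=x^{\vee}\in\mathbb C^n$ are defined by $$\hat x_t=\frac{1}{\sqrt n}\sum_{s=0}^{n-1}x_s\zeta_n^{st},\qquad \check x_t=\frac{1}{\sqrt n}\sum_{s=0}^{n-1}x_s\zeta_n^{-st},\qquad t\in\{0,1,\ldots,n-1\}.$$ Composite means an integer greater than $1$ that is not prime. *)

theory Defs
  imports
    "Jordan_Normal_Form.Matrix"
    "HOL-Computational_Algebra.Primes"
    Complex_Main
begin

definition zeta :: "nat \<Rightarrow> complex" where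
  "zeta n = exp (2 * complex_of_real pi * \<i> / of_nat n)"

definition fourier :: "complex vec \<Rightarrow> complex vec" where
  "fourier x = (let n = dim_vec x in
     vec n (\<lambda>t. 1 / complex_of_real (sqrt (real n)) *
       (\<Sum>s<n. x $ s * zeta n ^ (s * t))))"

definition inv_fourier :: "complex vec \<Rightarrow> complex vec" where
  "inv_fourier x = (let n = dim_vec x in
     vec n (\<lambda>t. 1 / complex_of_real (sqrt (real n)) *
       (\<Sum>s<n. x $ s * zeta n powi (- int (s * t)))))"

definition composite :: "nat \<Rightarrow> bool" where
  "composite n \<longleftrightarrow> n > 1 \<and> \<not> prime n"

end

theory Submission
  imports Defs "HOL-Computational_Algebra.Polynomial" "HOL-Number_Theory.Cong"
begin

text \<open>For the family, take characters supported on the cosets \<open>k + m\<int>\<close>, where \<open>n = d m\<close>; the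
  condition \<open>d < sqrt (2 n)\<close> makes \<open>0, \<dots>, d div 2\<close> distinct residues modulo \<open>m\<close>. A composite \<open>n\<close>
  has a divisor \<open>1 < d \<le> sqrt n\<close>, which yields a pair.

  For prime \<open>n = p\<close>, Chebotarev's theorem implies that a nonzero vector has more nonzero entries
  than its transform has zeros; applied to \<open>u\<close> and \<open>v\<close> this is incompatible with disjoint supports
  on both sides. Chebotarev's theorem is proved by reduction at \<open>p\<close>, using a valuation ring of the
  coefficient field in which \<open>p\<close> is not invertible. A kernel vector of a minor can be scaled to have
  entries in this ring, one of them 1. It gives a polynomial with \<open>k\<close> terms and \<open>k\<close> roots among the
  \<open>p\<close>-th roots of unity, all of which reduce to 1. A polynomial with \<open>k\<close> terms and degree below \<open>p\<close>
  cannot vanish to order \<open>k\<close> at 1 in characteristic \<open>p\<close>.\<close>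

section \<open>Subrings of a field\<close>

locale unital_subring =
  fixes A :: "'a::field set"
  assumes one_mem: "1 \<in> A"
    and diff_mem: "\<lbrakk>x \<in> A; y \<in> A\<rbrakk> \<Longrightarrow> x - y \<in> A"
    and mult_mem: "\<lbrakk>x \<in> A; y \<in> A\<rbrakk> \<Longrightarrow> x * y \<in> A"
begin

lemma zero_mem: "0 \<in> A"
  using diff_mem[OF one_mem one_mem] by simp

lemma uminus_mem: "x \<in> A \<Longrightarrow> - x \<in> A"
  using diff_mem[OF zero_mem] by fastforce

lemma add_mem: "\<lbrakk>x \<in> A; y \<in> A\<rbrakk> \<Longrightarrow> x + y \<in> A"
  using diff_mem[OF _ uminus_mem] by fastforce

lemma sum_mem: "(\<And>i. i \<in> I \<Longrightarrow> f i \<in> A) \<Longrightarrow> sum f I \<in> A"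
  by (induction I rule: infinite_finite_induct) (auto simp: zero_mem add_mem)

lemma power_mem: "x \<in> A \<Longrightarrow> x ^ k \<in> A"
  by (induction k) (auto simp: one_mem mult_mem)

lemma of_nat_mem: "of_nat k \<in> A"
  by (induction k) (auto simp: zero_mem one_mem add_mem)

lemma of_int_mem: "of_int k \<in> A"
  by (cases k) (auto simp: of_nat_mem uminus_mem simp del: of_nat_Suc of_int_add of_int_diff)

lemma coeff_mult_mem:
  assumes "\<And>i. coeff f i \<in> A" "\<And>i. coeff g i \<in> A"
  shows "coeff (f * g) i \<in> A"
  unfolding coeff_mult by (intro sum_mem mult_mem assms)

text \<open>This set is \<open>A[x]\<close>, the extension against which maximality is tested
  later.\<close>

lemma adjoin: "unital_subring {poly f x |f. \<forall>i. coeff f i \<in> A}"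
proof
  show "1 \<in> {poly f x |f. \<forall>i. coeff f i \<in> A}"
    by (auto intro!: exI[of _ 1] simp: coeff_1 one_mem zero_mem)
next
  fix y z assume "y \<in> {poly f x |f. \<forall>i. coeff f i \<in> A}" "z \<in> {poly f x |f. \<forall>i. coeff f i \<in> A}"
  then obtain f g where fg: "y = poly f x" "\<And>i. coeff f i \<in> A" "z = poly g x" "\<And>i. coeff g i \<in> A"
    by blast
  show "y - z \<in> {poly f x |f. \<forall>i. coeff f i \<in> A}"
    using fg by (auto intro!: exI[of _ "f - g"] diff_mem)
  show "y * z \<in> {poly f x |f. \<forall>i. coeff f i \<in> A}"
    using fg by (auto intro!: exI[of _ "f * g"] coeff_mult_mem)
qed

end

section \<open>Maximal subrings without \<open>1/p\<close> as valuation rings\<close>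

text \<open>A subring that is maximal among those not containing \<open>1/p\<close> is a valuation ring: \<open>1 + pA\<close>
  consists of units, and if neither \<open>x\<close> nor \<open>1/x\<close> were in \<open>A\<close>, then both \<open>A[x]\<close> and \<open>A[1/x]\<close>
  would contain \<open>1/p\<close>; combining two polynomial expressions of minimal degree lowers a degree.\<close>

locale maximal_subring_avoiding = unital_subring A for A :: "'a::field_char_0 set" +
  fixes p :: nat
  assumes p_pos: "p > 0"
    and avoids: "inverse (of_nat p) \<notin> A"
    and maximal: "\<lbrakk>unital_subring B; A \<subseteq> B; inverse (of_nat p) \<notin> B\<rbrakk> \<Longrightarrow> B = A"
begin

text \<open>The localization \<open>B\<close> of \<open>A\<close> at \<open>1 + pA\<close> still
  avoids \<open>1/p\<close>: from \<open>1/p = a / (1 + p * b)\<close> follows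
  \<open>1/p = a - b\<close>, an element of \<open>A\<close>. Maximality then gives
  \<open>B = A\<close>.\<close>

lemma inverse_one_plus_mem:
  assumes "b \<in> A"
  shows "1 + of_nat p * b \<noteq> 0" "inverse (1 + of_nat p * b) \<in> A"
proof -
  have p0: "of_nat p \<noteq> (0::'a)" using p_pos by simp
  have nz: "1 + of_nat p * b \<noteq> 0" if "b \<in> A" for b
  proof
    assume "1 + of_nat p * b = 0"
    then have "inverse (of_nat p) = - b" using p0
      by (simp add: inverse_eq_divide nonzero_divide_eq_eq add_eq_0_iff mult.commute)
    then show False using avoids uminus_mem[OF that] by simp
  qed
  show "1 + of_nat p * b \<noteq> 0" by (rule nz[OF assms])
  define B where "B = {a / (1 + of_nat p * b) |a b. a \<in> A \<and> b \<in> A}"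
  have "unital_subring B"
  proof
    show "1 \<in> B" unfolding B_def using one_mem zero_mem
      by (auto intro!: exI[of _ 1] exI[of _ 0])
  next
    fix x y assume "x \<in> B" "y \<in> B"
    then obtain a b c d where *: "a \<in> A" "b \<in> A" "c \<in> A" "d \<in> A"
      and xy: "x = a / (1 + of_nat p * b)" "y = c / (1 + of_nat p * d)" unfolding B_def by blast
    have e: "(1 + of_nat p * b) * (1 + of_nat p * d) = 1 + of_nat p * (b + d + of_nat p * (b * d))"
      by (simp add: algebra_simps)
    have m: "b + d + of_nat p * (b * d) \<in> A"
      by (intro add_mem mult_mem of_nat_mem *)
    have "x * y = a * c / (1 + of_nat p * (b + d + of_nat p * (b * d)))"
      unfolding xy e[symmetric] by simp
    then show "x * y \<in> B" unfolding B_def using m * mult_mem by blast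
    have "x - y = (a * (1 + of_nat p * d) - c * (1 + of_nat p * b)) /
      (1 + of_nat p * (b + d + of_nat p * (b * d)))"
      unfolding xy e[symmetric] using nz[OF *(2)] nz[OF *(4)] by (simp add: diff_frac_eq)
    moreover have "a * (1 + of_nat p * d) - c * (1 + of_nat p * b) \<in> A"
      by (intro add_mem mult_mem diff_mem of_nat_mem one_mem *)
    ultimately show "x - y \<in> B" unfolding B_def using m by blast
  qed
  moreover have "A \<subseteq> B"
  proof
    fix a assume "a \<in> A"
    moreover have "a = a / (1 + of_nat p * 0)" by simp
    ultimately show "a \<in> B" unfolding B_def using zero_mem by blast
  qed
  moreover have "inverse (of_nat p) \<notin> B"
  proof
    assume "inverse (of_nat p) \<in> B"
    then obtain a b where *: "a \<in> A" "b \<in> A" "inverse (of_nat p) = a / (1 + of_nat p * b)"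
      unfolding B_def by blast
    then have "1 + of_nat p * b = of_nat p * a"
      using p0 nz[OF *(2)] by (simp add: inverse_eq_divide frac_eq_eq mult.commute)
    then have "of_nat p * (a - b) = 1" by (simp add: algebra_simps)
    then have "inverse (of_nat p) = a - b" by (rule inverse_unique)
    then show False using avoids diff_mem[OF *(1,2)] by simp
  qed
  ultimately have "B = A" by (rule maximal)
  moreover have "inverse (1 + of_nat p * b) \<in> B" unfolding B_def using one_mem assms
    by (auto simp: inverse_eq_divide)
  ultimately show "inverse (1 + of_nat p * b) \<in> A" by simp
qed

text \<open>This expresses that \<open>1/p\<close> lies in \<open>A[x]\<close> through an expression
  of degree at most \<open>n\<close>; the coefficient \<open>a n\<close> may vanish.\<close>

definition inverts :: "'a \<Rightarrow> nat \<Rightarrow> bool" where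
  "inverts x n \<longleftrightarrow> (\<exists>a. (\<forall>i. a i \<in> A) \<and> of_nat p * (\<Sum>i\<le>n. a i * x ^ i) = 1)"

lemma inverts_if_not_mem:
  assumes "x \<notin> A"
  shows "\<exists>n. inverts x n"
proof -
  have "inverse (of_nat p) \<in> {poly f x |f. \<forall>i. coeff f i \<in> A}" (is "_ \<in> ?B")
  proof (rule ccontr)
    assume "inverse (of_nat p) \<notin> ?B"
    moreover have "A \<subseteq> ?B"
    proof
      fix a assume "a \<in> A"
      then show "a \<in> ?B"
        by (auto intro!: exI[of _ "[:a:]"] simp: coeff_pCons zero_mem split: nat.split)
    qed
    ultimately have "?B = A" using maximal adjoin by blast
    moreover have "x \<in> ?B"
      by (auto intro!: exI[of _ "[:0, 1:]"] simp: coeff_pCons zero_mem one_mem split: nat.split)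
    ultimately show False using assms by simp
  qed
  then obtain f where f: "\<And>i. coeff f i \<in> A" "inverse (of_nat p) = poly f x" by blast
  have "of_nat p * (\<Sum>i\<le>degree f. coeff f i * x ^ i) = 1"
    unfolding poly_altdef[symmetric] f(2)[symmetric] using p_pos by simp
  then show ?thesis unfolding inverts_def using f(1) by blast
qed

text \<open>Since \<open>1 - p * b 0\<close> is a unit of \<open>A\<close>, the relation for
  \<open>inverse x\<close>, multiplied by \<open>x ^ n\<close>, expresses \<open>x ^ n\<close>
  through lower powers of \<open>x\<close>. This replaces the leading term in the relation for
  \<open>x\<close>.\<close>

lemma inverts_reduce:
  assumes x0: "x \<noteq> 0" and n: "inverts x n" and m: "inverts (inverse x) m" and le: "m \<le> n"
  shows "n > 0 \<and> inverts x (n - 1)"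
proof -
  obtain a where a: "\<And>i. a i \<in> A" "of_nat p * (\<Sum>i\<le>n. a i * x ^ i) = 1"
    using n unfolding inverts_def by blast
  obtain b where b: "\<And>i. b i \<in> A" "of_nat p * (\<Sum>i\<le>m. b i * inverse x ^ i) = 1"
    using m unfolding inverts_def by blast
  have n0: "n > 0"
  proof (rule ccontr)
    assume "\<not> n > 0"
    then have "of_nat p * a 0 = 1" using a(2) by simp
    then have "inverse (of_nat p) = a 0" by (rule inverse_unique)
    then show False using avoids a(1) by simp
  qed
  \<comment> \<open>Reversed coefficients: \<open>b i\<close> moves to exponent
    \<open>n - i\<close>. The index \<open>j = n\<close>, which would bring back \<open>b 0\<close>,
    stays outside the sums below.\<close>
  define e where "e j = (if n - m \<le> j then b (n - j) else 0)" for j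
  define s where "s = inverse (1 + of_nat p * (- b 0))"
  have s: "s \<in> A" "s * (1 - of_nat p * b 0) = 1"
    using inverse_one_plus_mem[OF uminus_mem[OF b(1)[of 0]]] unfolding s_def by simp_all
  have "1 - of_nat p * b 0 = of_nat p * (\<Sum>i\<in>{1..m}. b i * inverse x ^ i)"
  proof -
    have "{..m} = insert 0 {1..m}" by auto
    then have "(\<Sum>i\<le>m. b i * inverse x ^ i) = b 0 + (\<Sum>i\<in>{1..m}. b i * inverse x ^ i)"
      by simp
    then show ?thesis using b(2) by (simp add: algebra_simps)
  qed
  then have "1 = s * (of_nat p * (\<Sum>i\<in>{1..m}. b i * inverse x ^ i))" using s(2) by simp
  then have "x ^ n = s * of_nat p * ((\<Sum>i\<in>{1..m}. b i * inverse x ^ i) * x ^ n)"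
    by (simp add: mult.assoc[symmetric])
  also have "(\<Sum>i\<in>{1..m}. b i * inverse x ^ i) * x ^ n = (\<Sum>i\<in>{1..m}. b i * x ^ (n - i))"
    unfolding sum_distrib_right
  proof (rule sum.cong[OF refl])
    fix i assume "i \<in> {1..m}"
    then have "i \<le> n" using le by simp
    then have "x ^ n = x ^ i * x ^ (n - i)" by (simp add: power_add[symmetric])
    then show "b i * inverse x ^ i * x ^ n = b i * x ^ (n - i)"
      using x0 by (simp add: power_inverse)
  qed
  also have "\<dots> = (\<Sum>j\<in>{n-m..n-1}. b (n - j) * x ^ j)"
    by (rule sum.reindex_bij_witness[of _ "\<lambda>j. n - j" "\<lambda>i. n - i"]) (use le n0 in auto)
  also have "\<dots> = (\<Sum>j\<le>n-1. e j * x ^ j)"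
    unfolding e_def by (rule sum.mono_neutral_cong_left) auto
  finally have xn: "x ^ n = s * of_nat p * (\<Sum>j\<le>n-1. e j * x ^ j)" .
  define c where "c j = a j + a n * (s * of_nat p * e j)" for j
  have "c j \<in> A" for j unfolding c_def e_def
    using a(1) b(1) s(1) by (auto intro!: add_mem mult_mem of_nat_mem zero_mem)
  moreover have "(\<Sum>i\<le>n. a i * x ^ i) = (\<Sum>j\<le>n-1. c j * x ^ j)"
  proof -
    have "(\<Sum>i\<le>n. a i * x ^ i) = (\<Sum>j\<le>n-1. a j * x ^ j) + a n * x ^ n"
      using n0 by (cases n) auto
    also have "\<dots> = (\<Sum>j\<le>n-1. a j * x ^ j + a n * (s * of_nat p * (e j * x ^ j)))"
      unfolding xn sum_distrib_left sum.distrib ..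
    also have "\<dots> = (\<Sum>j\<le>n-1. c j * x ^ j)"
      unfolding c_def by (intro sum.cong refl) (simp add: distrib_right mult.assoc)
    finally show ?thesis .
  qed
  then have "of_nat p * (\<Sum>j\<le>n-1. c j * x ^ j) = 1" using a(2) by simp
  ultimately have "inverts x (n - 1)" unfolding inverts_def by blast
  then show ?thesis using n0 by simp
qed

lemma mem_or_inverse_mem: "x \<in> A \<or> inverse x \<in> A"
proof (rule ccontr)
  assume c: "\<not> (x \<in> A \<or> inverse x \<in> A)"
  then have x0: "x \<noteq> 0" using zero_mem by auto
  define n where "n = (LEAST n. inverts x n)"
  define m where "m = (LEAST m. inverts (inverse x) m)"
  have n: "inverts x n" unfolding n_def using c by (intro LeastI_ex[OF inverts_if_not_mem]) simp
  have m: "inverts (inverse x) m" unfolding m_def using c by (intro LeastI_ex[OF inverts_if_not_mem]) simp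
  show False
  \<comment> \<open>The larger of the two minimal degrees is lowered; the second case swaps
    \<open>x\<close> and \<open>inverse x\<close>.\<close>
  proof (cases "m \<le> n")
    case True
    have "n > 0" "inverts x (n - 1)" using inverts_reduce[OF x0 n m True] by auto
    then show False using Least_le[of "inverts x" "n - 1"] unfolding n_def[symmetric] by simp
  next
    case False
    have "m > 0" "inverts (inverse x) (m - 1)"
      using inverts_reduce[of "inverse x" m n] x0 n m False by auto
    then show False using Least_le[of "inverts (inverse x)" "m - 1"] unfolding m_def[symmetric] by simp
  qed
qed

end

text \<open>Zorn's lemma applies: \<open>\<int>\<close> avoids \<open>1/p\<close> because
  \<open>p > 1\<close>, and the union of a chain is a subring because any two of its elements lie in
  a common member.\<close>

lemma exists_maximal_subring_avoiding:
  assumes "p > 1"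
  shows "\<exists>A :: 'a::field_char_0 set. maximal_subring_avoiding A p"
proof -
  define S where "S = {A :: 'a set. unital_subring A \<and> inverse (of_nat p) \<notin> A}"
  have "\<int> \<in> S"
  proof -
    have "unital_subring (\<int> :: 'a set)" by standard auto
    moreover have "inverse (of_nat p) \<notin> (\<int> :: 'a set)"
    proof
      assume "inverse (of_nat p) \<in> (\<int> :: 'a set)"
      then obtain k where "inverse (of_nat p) = (of_int k :: 'a)" by (elim Ints_cases)
      then have "of_nat p * of_int k = (1::'a)" using assms by (simp add: field_simps)
      then have "of_int (int p * k) = (of_int 1::'a)" by simp
      then have "int p * k = 1" by (simp only: of_int_eq_iff)
      then show False using assms by (simp add: zmult_eq_1_iff)
    qed
    ultimately show ?thesis by (simp add: S_def)
  qed
  have "\<exists>M\<in>S. \<forall>X\<in>S. M \<subseteq> X \<longrightarrow> X = M"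
  proof (rule subset_Zorn_nonempty)
    show "S \<noteq> {}" using \<open>\<int> \<in> S\<close> by blast
  next
    fix C assume C: "C \<noteq> {}" "subset.chain S C"
    then have CS: "\<And>X. X \<in> C \<Longrightarrow> unital_subring X \<and> inverse (of_nat p) \<notin> X"
      by (auto simp: subset.chain_def S_def)
    have "unital_subring (\<Union>C)"
    proof
      show "1 \<in> \<Union>C" using C(1) CS unital_subring.one_mem by fastforce
    next
      fix x y assume "x \<in> \<Union>C" "y \<in> \<Union>C"
      then obtain X where X: "X \<in> C" "x \<in> X" "y \<in> X"
        using C(2) unfolding subset_chain_def by blast
      show "x - y \<in> \<Union>C" using X CS unital_subring.diff_mem by blast
      show "x * y \<in> \<Union>C" using X CS unital_subring.mult_mem by blast
    qed
    then show "\<Union>C \<in> S" using CS by (auto simp: S_def)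
  qed
  then obtain M where "M \<in> S" "\<And>X. X \<in> S \<Longrightarrow> M \<subseteq> X \<Longrightarrow> X = M" by blast
  then have "maximal_subring_avoiding M p"
    using assms unfolding S_def maximal_subring_avoiding_def maximal_subring_avoiding_axioms_def by auto
  then show ?thesis by blast
qed

section \<open>The maximal ideal of the valuation ring and reduction at \<open>p\<close>\<close>

context maximal_subring_avoiding
begin

text \<open>The maximal ideal of \<open>A\<close>. Zero is listed separately because
  \<open>inverse 0 = 0\<close> lies in \<open>A\<close>.\<close>

definition nonunits :: "'a set" where
  "nonunits = {x \<in> A. x = 0 \<or> inverse x \<notin> A}"

lemma nonunits_imp_mem: "x \<in> nonunits \<Longrightarrow> x \<in> A"
  by (simp add: nonunits_def)

lemma one_not_nonunit: "1 \<notin> nonunits"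
  by (simp add: nonunits_def one_mem)

lemma zero_nonunit: "0 \<in> nonunits"
  by (simp add: nonunits_def zero_mem)

lemma of_nat_p_nonunit: "of_nat p \<in> nonunits"
  using avoids by (simp add: nonunits_def of_nat_mem)

lemma mult_nonunit:
  assumes "a \<in> A" "x \<in> nonunits"
  shows "a * x \<in> nonunits"
proof (cases "a * x = 0")
  case False
  have "inverse (a * x) \<notin> A"
  proof
    assume "inverse (a * x) \<in> A"
    then have "a * inverse (a * x) \<in> A" using assms mult_mem by blast
    moreover have "a * inverse (a * x) = inverse x" using False by (simp add: field_simps)
    ultimately have "inverse x \<in> A" by (simp only:)
    then show False using assms False by (auto simp: nonunits_def)
  qed
  then show ?thesis using assms by (auto simp: nonunits_def mult_mem)
qed (auto simp: zero_nonunit)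

text \<open>By the valuation property one summand is an \<open>A\<close>-multiple of the other, and
  hence so is the sum.\<close>

lemma add_nonunit:
  assumes "x \<in> nonunits" "y \<in> nonunits"
  shows "x + y \<in> nonunits"
proof (cases "x = 0 \<or> y = 0")
  case True
  then show ?thesis using assms by auto
next
  case False
  have "x / y \<in> A \<or> y / x \<in> A" using mem_or_inverse_mem[of "x / y"] by simp
  then show ?thesis
  proof
    assume "x / y \<in> A"
    then have "(x / y + 1) * y \<in> nonunits" using assms by (intro mult_nonunit add_mem one_mem)
    then show ?thesis using False by (simp add: field_simps)
  next
    assume "y / x \<in> A"
    then have "(1 + y / x) * x \<in> nonunits" using assms by (intro mult_nonunit add_mem one_mem)
    then show ?thesis using False by (simp add: field_simps)
  qed
qed

lemma diff_nonunit: "\<lbrakk>x \<in> nonunits; y \<in> nonunits\<rbrakk> \<Longrightarrow> x - y \<in> nonunits"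
  using add_nonunit[of x "(- 1) * y"] mult_nonunit[of "- 1" y] uminus_mem[OF one_mem] by simp

text \<open>Otherwise a Bezout identity would make 1 a nonunit. In other words, the residue field
  has characteristic \<open>p\<close>.\<close>

lemma coprime_of_int_not_nonunit:
  assumes "coprime k (int p)"
  shows "of_int k \<notin> nonunits"
proof
  assume k: "of_int k \<in> nonunits"
  obtain a b where "a * k + b * int p = 1"
    using assms bezout_int[of k "int p"] by auto
  then have "of_int a * of_int k + of_int b * of_nat p = (1::'a)"
    by (metis of_int_1 of_int_add of_int_mult of_int_of_nat_eq)
  moreover have "of_int a * of_int k + of_int b * of_nat p \<in> nonunits"
    by (intro add_nonunit mult_nonunit of_int_mem k of_nat_p_nonunit)
  ultimately show False using one_not_nonunit by simp
qed

text \<open>\<open>w\<close> equals \<open>inverse w ^ (k - 1)\<close>, so it lies in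
  \<open>A\<close> as soon as its inverse does.\<close>

lemma root_of_unity_mem:
  assumes "w ^ k = 1" "k > 0"
  shows "w \<in> A"
proof (rule ccontr)
  assume "w \<notin> A"
  then have "inverse w ^ (k - 1) \<in> A" using mem_or_inverse_mem power_mem by blast
  moreover have "w * w ^ (k - 1) = 1" using assms by (simp flip: power_Suc)
  then have "inverse (w ^ (k - 1)) = w" using inverse_unique[of "w ^ (k - 1)" w]
    by (simp add: mult.commute)
  ultimately show False using \<open>w \<notin> A\<close> by (simp add: power_inverse)
qed

text \<open>Expanding \<open>(1 + c)\<^sup>p = 1\<close> shows that \<open>c\<^sup>p\<close> is divisible by \<open>p\<close>.\<close>

lemma root_of_unity_minus_one_nonunit:
  assumes "prime p" "w ^ p = 1"
  shows "w - 1 \<in> nonunits"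
proof (rule ccontr)
  define c where "c = w - 1"
  assume "w - 1 \<notin> nonunits"
  moreover have c: "c \<in> A" unfolding c_def
    using root_of_unity_mem[OF assms(2) p_pos] one_mem diff_mem by blast
  ultimately have c0: "c \<noteq> 0" "inverse c \<in> A" by (auto simp: nonunits_def c_def)
  have "(\<Sum>k\<le>p. of_nat (p choose k) * c ^ k) = 1"
    using binomial_ring[of c 1 p] assms(2) by (simp add: c_def)
  moreover have "{..p} = insert 0 (insert p {1..<p})" using p_pos by auto
  ultimately have e: "c ^ p = - (\<Sum>k\<in>{1..<p}. of_nat (p choose k) * c ^ k)"
    using p_pos by (simp add: add_eq_0_iff2)
  have "of_nat (p choose k) = of_nat p * (of_nat ((p choose k) div p) :: 'a)" if "k \<in> {1..<p}" for k
  proof -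
    have "p dvd (p choose k)" using that assms(1) by (intro dvd_choose_prime) auto
    then show ?thesis by (metis dvd_mult_div_cancel of_nat_mult)
  qed
  then have "c ^ p = of_nat p * - (\<Sum>k\<in>{1..<p}. of_nat ((p choose k) div p) * c ^ k)"
    unfolding e by (simp add: sum_distrib_left mult.assoc)
  also have "\<dots> \<in> nonunits"
    unfolding mult.commute[of "of_nat p"]
    by (intro mult_nonunit of_nat_p_nonunit uminus_mem sum_mem mult_mem of_nat_mem power_mem c)
  finally have "inverse c ^ p * c ^ p \<in> nonunits"
    using c0 by (intro mult_nonunit power_mem)
  then show False using c0 one_not_nonunit by (simp add: power_inverse)
qed

section \<open>Orders of vanishing modulo the maximal ideal\<close>

text \<open>Modulo \<open>nonunits\<close> each linear factor \<open>X - c\<close> becomes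
  \<open>X\<close>, so \<open>f\<close> becomes divisible by \<open>X\<close> to the power
  \<open>card C\<close>. The factors are split off one at a time.\<close>

lemma coeff_nonunit_if_roots_nonunit:
  assumes "\<And>i. coeff f i \<in> A" "finite C" "C \<subseteq> nonunits" "\<And>c. c \<in> C \<Longrightarrow> poly f c = 0"
    and "r < card C"
  shows "coeff f r \<in> nonunits"
  using assms(2,1,3-)
proof (induction C arbitrary: f r rule: finite_induct)
  case (insert c C)
  obtain h where h: "f = [:- c, 1:] * h"
    using insert.prems(3)[of c] by (auto simp: poly_eq_0_iff_dvd)
  have c: "c \<in> nonunits" using insert.prems by simp
  have rec: "coeff h i = coeff f (Suc i) + c * coeff h (Suc i)" for i
    unfolding h by simp
  \<comment> \<open>The recursion \<open>rec\<close> yields the coefficients of \<open>h\<close>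
    from the top down, starting with the zero one at \<open>Suc (degree h)\<close>.\<close>
  have hA: "coeff h i \<in> A" for i
  proof (cases "i \<le> Suc (degree h)")
    case True
    then show ?thesis
    proof (induction i rule: inc_induct)
      case base
      then show ?case by (simp add: coeff_eq_0 zero_mem)
    next
      case (step i)
      then show ?case using rec[of i]
        insert.prems(1) nonunits_imp_mem[OF c] by (auto intro!: add_mem mult_mem)
    qed
  qed (simp add: coeff_eq_0 zero_mem)
  have "poly h c' = 0" if "c' \<in> C" for c'
    using insert.prems(3)[of c'] that insert.hyps(2) unfolding h by auto
  then have IH: "coeff h i \<in> nonunits" if "i < card C" for i
    using insert.IH[of h i] hA insert.prems that by auto
  have ch: "coeff h i * c \<in> nonunits" for i using mult_nonunit[OF hA c] .
  show ?case
  proof (cases r)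
    case 0
    then have "coeff f r = 0 - coeff h 0 * c" unfolding h by simp
    then show ?thesis using diff_nonunit[OF zero_nonunit ch] by simp
  next
    case (Suc i)
    then have "coeff f r = coeff h i - coeff h r * c" unfolding h by simp
    moreover have "coeff h i \<in> nonunits" using IH Suc insert by simp
    ultimately show ?thesis using diff_nonunit ch by simp
  qed
qed simp

text \<open>Multiplying the weights \<open>a i\<close> by \<open>i - m\<close> costs one order of vanishing, because
  \<open>i * (i choose r) = (r + 1) * (i choose (r + 1)) + r * (i choose r)\<close>.\<close>

lemma binomial_moments_nonunit:
  assumes "finite M"
    and "\<And>r. r < k \<Longrightarrow> (\<Sum>i\<in>I. a i * of_nat (i choose r)) \<in> nonunits"
    and "r + card M < k"
  shows "(\<Sum>i\<in>I. a i * of_int (\<Prod>m\<in>M. int i - int m) * of_nat (i choose r)) \<in> nonunits"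
  using assms
proof (induction M arbitrary: r rule: finite_induct)
  case (insert m M)
  define b where "b i = a i * of_int (\<Prod>m\<in>M. int i - int m)" for i
  have IH: "(\<Sum>i\<in>I. b i * of_nat (i choose r)) \<in> nonunits" if "r + card M < k" for r
    unfolding b_def using insert.IH insert.prems(1) that by blast
  have absorb: "of_nat i * of_nat (i choose r) =
      of_nat (Suc r) * of_nat (i choose Suc r) + of_nat r * (of_nat (i choose r) :: 'a)" for i
  proof -
    have "i * (i choose r) = Suc r * (i choose Suc r) + r * (i choose r)"
    proof (cases "r \<le> i")
      case True
      then have "i * (i choose r) = (i - r) * (i choose r) + r * (i choose r)"
        by (simp flip: add_mult_distrib)
      then show ?thesis by (simp only: binomial_absorb_comp binomial_absorption)
    qed (simp add: binomial_eq_0)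
    then show ?thesis by (metis of_nat_add of_nat_mult)
  qed
  have "(\<Sum>i\<in>I. a i * of_int (\<Prod>m\<in>insert m M. int i - int m) * of_nat (i choose r))
      = (\<Sum>i\<in>I. b i * (of_nat i * of_nat (i choose r) - of_nat m * of_nat (i choose r)))"
    unfolding b_def using insert.hyps by (simp add: algebra_simps)
  also have "\<dots> = of_nat (Suc r) * (\<Sum>i\<in>I. b i * of_nat (i choose Suc r))
      + of_int (int r - int m) * (\<Sum>i\<in>I. b i * of_nat (i choose r))"
    unfolding absorb by (simp add: sum_distrib_left sum_subtractf sum.distrib algebra_simps del: of_nat_Suc)
  \<comment> \<open>The induction hypothesis is used at \<open>Suc r\<close> and at
    \<open>r\<close>; the factor for \<open>m\<close> in the bound leaves room for
    \<open>Suc r\<close>.\<close>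
  also have "\<dots> \<in> nonunits"
    using insert.prems(2) insert.hyps
    by (intro add_nonunit mult_nonunit of_nat_mem of_int_mem IH) auto
  finally show ?case .
qed simp

text \<open>Of two inverse quotients one lies in \<open>A\<close>, so divisibility is total and some
  entry divides all others. Dividing by it puts a vector into \<open>A\<close> with one entry
  1.\<close>

lemma finite_max_quotients:
  assumes "finite I" "i \<in> I" "u i \<noteq> 0"
  shows "\<exists>l\<in>I. u l \<noteq> 0 \<and> (\<forall>i\<in>I. u i / u l \<in> A)"
  using assms
proof (induction I arbitrary: i rule: finite_induct)
  case (insert j I)
  show ?case
  proof (cases "\<exists>i\<in>I. u i \<noteq> 0")
    case False
    then have "u j \<noteq> 0" using insert.prems by auto
    then show ?thesis using False by (intro bexI[of _ j]) (auto simp: one_mem zero_mem)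
  next
    case True
    then obtain l where l: "l \<in> I" "u l \<noteq> 0" "\<forall>i\<in>I. u i / u l \<in> A" using insert.IH by blast
    show ?thesis
    proof (cases "u j / u l \<in> A")
      case True
      then show ?thesis using l by auto
    next
      case False
      then have lj: "u l / u j \<in> A" using mem_or_inverse_mem[of "u j / u l"] by simp
      have "u j \<noteq> 0" using False zero_mem by auto
      moreover have "u i / u j \<in> A" if "i \<in> I" for i
      proof -
        have "u i / u l * (u l / u j) \<in> A" using l that lj by (intro mult_mem) auto
        then show ?thesis using l(2) by simp
      qed
      ultimately show ?thesis using one_mem by (intro bexI[of _ j]) auto
    qed
  qed
qed simp

end

section \<open>Chebotarev's theorem\<close>

text \<open>Equivalently, for \<open>w\<close> a primitive \<open>p\<close>-th root of unity, all square minors of the Fourier matrix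
  are nonzero (Chebotarev).\<close>

theorem chebotarev_vanishing:
  fixes w :: "'a::field_char_0" and u :: "nat \<Rightarrow> 'a"
  assumes p: "prime p" and w: "w ^ p = 1" "inj_on (\<lambda>j. w ^ j) J"
    and IJ: "I \<subseteq> {..<p}" "finite J" "card I \<le> card J"
    and vanish: "\<And>j. j \<in> J \<Longrightarrow> (\<Sum>i\<in>I. u i * w ^ (i * j)) = 0"
    and i: "i \<in> I"
  shows "u i = 0"
proof (rule ccontr)
  assume ui: "u i \<noteq> 0"
  have fin: "finite I" using IJ(1) finite_subset by blast
  obtain A :: "'a set" where "maximal_subring_avoiding A p"
    using exists_maximal_subring_avoiding[of p] prime_gt_1_nat[OF p] by blast
  then interpret maximal_subring_avoiding A p .
  obtain l where l: "l \<in> I" "u l \<noteq> 0" "\<forall>i\<in>I. u i / u l \<in> A"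
    using finite_max_quotients[of I i u] fin i ui by blast
  define a where "a i = u i / u l" for i
  have aA: "a i \<in> A" if "i \<in> I" for i using l that by (simp add: a_def)
  \<comment> \<open>Writing the polynomial in powers of \<open>1 + X\<close> moves its roots
    \<open>w ^ j\<close> to the nonunits \<open>w ^ j - 1\<close> and makes its coefficients
    binomial moments of \<open>a\<close>.\<close>
  define G where "G = (\<Sum>i\<in>I. smult (a i) ([:1, 1:] ^ i))"
  have coeff_lin: "coeff ([:1, 1:] ^ i) r = (of_nat (i choose r) :: 'a)" for i r
  proof -
    have "[:1, 1:] ^ i = (\<Sum>k\<le>i. monom (of_nat (i choose k)) k :: 'a poly)"
    proof -
      have "[:1, 1:] = [:0, 1:] + (1 :: 'a poly)" by (simp add: one_pCons)
      then show ?thesis using binomial_ring[of "[:0, 1::'a:]" 1 i]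
        by (simp add: monom_altdef of_nat_poly)
    qed
    then show ?thesis by (simp add: coeff_sum binomial_eq_0)
  qed
  have G: "coeff G r = (\<Sum>i\<in>I. a i * of_nat (i choose r))" for r
    unfolding G_def coeff_sum coeff_smult coeff_lin ..
  define C where "C = (\<lambda>j. w ^ j - 1) ` J"
  have "inj_on (\<lambda>j. w ^ j - 1) J" using w(2) by (auto simp: inj_on_def)
  then have card_C: "card C = card J" unfolding C_def by (rule card_image)
  have "(w ^ j) ^ p = 1" for j by (simp add: w(1) power_mult[symmetric] mult.commute[of j] power_mult)
  then have CN: "C \<subseteq> nonunits" unfolding C_def using root_of_unity_minus_one_nonunit[OF p] by blast
  have "poly G c = 0" if c: "c \<in> C" for c
  proof -
    obtain j where j: "j \<in> J" "c = w ^ j - 1" using c unfolding C_def by blast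
    have "poly G c = (\<Sum>i\<in>I. u i * w ^ (i * j)) / u l"
      unfolding G_def j a_def
      by (simp add: poly_sum sum_divide_distrib power_mult[symmetric] mult.commute)
    then show ?thesis using vanish j by simp
  qed
  moreover have "coeff G i \<in> A" for i unfolding G by (intro sum_mem mult_mem of_nat_mem aA)
  ultimately have moments: "(\<Sum>i\<in>I. a i * of_nat (i choose r)) \<in> nonunits" if "r < card J" for r
    using coeff_nonunit_if_roots_nonunit[of G C r] CN IJ(2) that card_C unfolding G[symmetric]
    by (simp add: C_def)
  \<comment> \<open>The product over \<open>M\<close> vanishes at every index of \<open>I\<close>
    except \<open>l\<close>, where \<open>a l = 1\<close>. It costs \<open>card M < card J\<close>
    orders, so the moment of order 0 remains available.\<close>
  define M where "M = I - {l}"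
  have M: "finite M" "0 + card M < card J"
    using IJ(3) l(1) fin card_Diff1_less[of I l] unfolding M_def by simp_all
  have "(\<Sum>i\<in>I. a i * of_int (\<Prod>m\<in>M. int i - int m)) \<in> nonunits"
    using binomial_moments_nonunit[OF M(1) moments M(2)] by simp
  also have "(\<Sum>i\<in>I. a i * of_int (\<Prod>m\<in>M. int i - int m)) =
      (\<Sum>i\<in>{l}. a i * of_int (\<Prod>m\<in>M. int i - int m))"
    using fin l(1) unfolding M_def
    by (intro sum.mono_neutral_right) (auto intro!: prod_zero bexI)
  finally have N: "of_int (\<Prod>m\<in>M. int l - int m) \<in> nonunits"
    using l(2) by (simp add: a_def)
  \<comment> \<open>Distinct \<open>l\<close> and \<open>m\<close> below \<open>p\<close> are
    incongruent modulo \<open>p\<close>.\<close>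
  moreover have "coprime (\<Prod>m\<in>M. int l - int m) (int p)"
  proof (rule prod_coprime_left)
    fix m assume m: "m \<in> M"
    have "\<not> int p dvd int l - int m"
    proof
      assume "int p dvd int l - int m"
      then have "[int l = int m] (mod int p)" by (simp add: cong_iff_dvd_diff)
      then show False using m l(1) IJ(1) cong_less_modulus_unique_nat[of l m p]
        by (auto simp: M_def cong_int_iff)
    qed
    then have "coprime (int p) (int l - int m)" using p by (intro prime_imp_coprime) simp_all
    then show "coprime (int l - int m) (int p)" by (rule coprime_commute[THEN iffD1])
  qed
  ultimately show False using coprime_of_int_not_nonunit by blast
qed

section \<open>Powers of \<open>zeta\<close> and the two transforms\<close>

lemma zeta_cis: "zeta n = cis (2 * pi / real n)"
  by (simp add: zeta_def cis_conv_exp mult_ac)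

lemma zeta_nonzero: "zeta n \<noteq> 0"
  by (simp add: zeta_def)

lemma zeta_power: "zeta n ^ k = cis (2 * pi * real k / real n)"
  unfolding zeta_cis DeMoivre by (simp add: mult_ac)

lemma zeta_power_self: "n > 0 \<Longrightarrow> zeta n ^ n = 1"
  by (simp add: zeta_power)

lemma inj_on_zeta_power: "n > 0 \<Longrightarrow> inj_on (\<lambda>k. zeta n ^ k) {..<n}"
  using bij_betw_roots_unity[of n] by (simp add: zeta_power bij_betw_def)

lemma zeta_power_eq_1_imp_dvd:
  assumes "n > 0" "zeta n ^ k = 1"
  shows "n dvd k"
proof -
  have "zeta n ^ k = zeta n ^ (n * (k div n) + k mod n)" by simp
  also have "\<dots> = zeta n ^ (k mod n)"
    using assms(1) by (simp only: power_add power_mult zeta_power_self power_one mult_1)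
  finally have "zeta n ^ (k mod n) = zeta n ^ 0" using assms(2) by simp
  then have "k mod n = 0" using inj_onD[OF inj_on_zeta_power[OF assms(1)], of "k mod n" 0] assms(1) by simp
  then show ?thesis by auto
qed

lemma fourier_index:
  assumes "x \<in> carrier_vec n" "t < n"
  shows "fourier x $ t = 1 / complex_of_real (sqrt (real n)) * (\<Sum>s<n. x $ s * zeta n ^ (s * t))"
  using assms by (auto simp: fourier_def Let_def)

lemma inv_fourier_index:
  assumes "x \<in> carrier_vec n" "t < n"
  shows "inv_fourier x $ t =
    1 / complex_of_real (sqrt (real n)) * (\<Sum>s<n. x $ s * inverse (zeta n) ^ (s * t))"
proof -
  have "zeta n powi (- int k) = inverse (zeta n) ^ k" for k
    by (simp add: power_int_minus power_inverse)
  then show ?thesis using assms by (auto simp: inv_fourier_def Let_def simp del: of_nat_mult)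
qed

section \<open>Zeros against supports for prime length\<close>

text \<open>Were the zeros at least as many as the support, Chebotarev's theorem with
  \<open>I\<close> the support and \<open>J\<close> the zeros would force \<open>x = 0\<close>. A
  general \<open>w\<close> serves both \<open>zeta p\<close> and its inverse.\<close>

lemma card_zeros_less_card_support:
  fixes w :: "'a::field_char_0"
  assumes "prime p" "w ^ p = 1" "inj_on (\<lambda>j. w ^ j) {..<p}"
    and x: "x \<in> carrier_vec p" "x \<noteq> 0\<^sub>v p"
  shows "card {t \<in> {..<p}. (\<Sum>s<p. x $ s * w ^ (s * t)) = 0} < card {s \<in> {..<p}. x $ s \<noteq> 0}"
    (is "card ?Z < card ?S")
proof (rule ccontr)
  assume "\<not> card ?Z < card ?S"
  then have le: "card ?S \<le> card ?Z" by simp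
  obtain i where i: "i < p" "x $ i \<noteq> 0" using x by (auto simp: vec_eq_iff)
  have "(\<Sum>s\<in>?S. x $ s * w ^ (s * t)) = (\<Sum>s<p. x $ s * w ^ (s * t))" for t
    by (rule sum.mono_neutral_left) auto
  then have "x $ i = 0"
    using assms le i
    by (intro chebotarev_vanishing[of p w ?Z ?S "\<lambda>s. x $ s" i])
       (auto intro: inj_on_subset)
  then show False using i by simp
qed

text \<open>Every index is a zero of one of the transforms, so there are at least \<open>p\<close>
  zeros in total. They are fewer than the entries of the two supports, which are disjoint among
  \<open>p\<close> indices.\<close>

lemma prime_no_pair:
  assumes "prime p" and u: "u \<in> carrier_vec p" "u \<noteq> 0\<^sub>v p" and v: "v \<in> carrier_vec p" "v \<noteq> 0\<^sub>v p"
    and uv: "\<And>i. i < p \<Longrightarrow> u $ i * v $ i = 0"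
    and fuv: "\<And>i. i < p \<Longrightarrow> fourier u $ i * inv_fourier v $ i = 0"
  shows False
proof -
  have p0: "p > 0" using assms(1) by (simp add: prime_gt_0_nat)
  let ?S = "\<lambda>x. {s \<in> {..<p}. x $ s \<noteq> (0::complex)}"
  let ?Z = "\<lambda>x w. {t \<in> {..<p}. (\<Sum>s<p. x $ s * w ^ (s * t)) = (0::complex)}"
  have inj: "inj_on (\<lambda>j. inverse (zeta p) ^ j) {..<p}"
    using inj_on_zeta_power[OF p0] by (auto simp: inj_on_def power_inverse)
  have "{..<p} \<subseteq> ?Z u (zeta p) \<union> ?Z v (inverse (zeta p))"
    using fuv p0 by (auto simp: fourier_index[OF u(1)] inv_fourier_index[OF v(1)])
  then have "card {..<p} \<le> card (?Z u (zeta p) \<union> ?Z v (inverse (zeta p)))"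
    by (intro card_mono) auto
  also have "\<dots> \<le> card (?Z u (zeta p)) + card (?Z v (inverse (zeta p)))" by (rule card_Un_le)
  also have "\<dots> < card (?S u) + card (?S v)"
    using card_zeros_less_card_support[OF assms(1) zeta_power_self[OF p0] inj_on_zeta_power[OF p0] u]
      card_zeros_less_card_support[OF assms(1) _ inj v] zeta_power_self[OF p0]
    by (auto simp: power_inverse)
  also have "\<dots> = card (?S u \<union> ?S v)"
    using uv by (intro card_Un_disjoint[symmetric]) auto
  also have "\<dots> \<le> card {..<p}" by (intro card_mono) auto
  finally show False by simp
qed

section \<open>Characters on cosets and their transforms\<close>

text \<open>The class consists of \<open>k + m * j\<close> with \<open>j < d\<close>, which leaves a
  geometric sum whose ratio \<open>q ^ m\<close> is a nontrivial \<open>d\<close>-th root of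
  unity.\<close>

lemma geometric_sum_residue_class:
  fixes q :: "'a::field"
  assumes "k < m" "q ^ (d * m) = 1" "q ^ m \<noteq> 1"
  shows "(\<Sum>s<d * m. if s mod m = k then q ^ s else 0) = 0"
proof -
  have "(\<Sum>s<d * m. if s mod m = k then q ^ s else 0) = (\<Sum>s\<in>{s \<in> {..<d * m}. s mod m = k}. q ^ s)"
    by (rule sum.inter_filter[symmetric]) simp
  also have "\<dots> = (\<Sum>j<d. q ^ (k + m * j))"
  proof (rule sum.reindex_bij_witness[of _ "\<lambda>j. k + m * j" "\<lambda>s. s div m"])
    fix j assume "j \<in> {..<d}"
    then have "m * Suc j \<le> m * d" by (intro mult_le_mono2) simp
    then show "k + m * j \<in> {s \<in> {..<d * m}. s mod m = k}"
      using assms(1) by (simp add: mult.commute)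
  qed (use assms(1) less_mult_imp_div_less in auto)
  also have "\<dots> = q ^ k * (\<Sum>j<d. (q ^ m) ^ j)"
    by (simp add: power_add power_mult sum_distrib_left)
  also have "\<dots> = 0"
    using assms(2) geometric_sum[OF assms(3), of d] by (simp add: power_mult[symmetric] mult.commute[of m])
  finally show ?thesis .
qed

text \<open>The vector \<open>coset_character n m k\<close> lives on the coset \<open>k + m\<int>\<close>, where it is a character chosen
  so that its transform lives on \<open>k + d\<int>\<close> and its inverse transform on \<open>- k + d\<int>\<close>, with \<open>n = d * m\<close>.\<close>

definition coset_character :: "nat \<Rightarrow> nat \<Rightarrow> nat \<Rightarrow> complex vec" where
  "coset_character n m k = vec n (\<lambda>s. if s mod m = k then inverse (zeta n) ^ (s * k) else 0)"

lemma coset_character_carrier: "coset_character n m k \<in> carrier_vec n"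
  by (simp add: coset_character_def)

text \<open>On the coset the summand is \<open>q ^ s\<close>, and \<open>ne\<close> says that
  \<open>q ^ m\<close> is not 1. Taking \<open>y\<close> as \<open>zeta n\<close> or its inverse
  covers both transforms.\<close>

lemma coset_character_sum_eq_0:
  assumes n: "n = d * m" "n > 0" and k: "k < m" and y: "y ^ n = 1"
    and ne: "y ^ (t * m) \<noteq> zeta n ^ (k * m)"
  shows "(\<Sum>s<n. coset_character n m k $ s * y ^ (s * t)) = 0"
proof -
  define q where "q = y ^ t * inverse (zeta n) ^ k"
  have "(\<Sum>s<n. coset_character n m k $ s * y ^ (s * t)) = (\<Sum>s<n. if s mod m = k then q ^ s else 0)"
    unfolding q_def
    by (intro sum.cong)
       (auto simp: coset_character_def power_mult_distrib power_mult[symmetric] mult.commute)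
  also have "\<dots> = 0"
    unfolding n(1)
  proof (rule geometric_sum_residue_class[OF k])
    have "q ^ n = (y ^ n) ^ t * inverse ((zeta n ^ n) ^ k)"
      unfolding q_def power_mult_distrib power_inverse power_mult[symmetric] by (simp add: mult.commute)
    then show "q ^ (d * m) = 1" using y zeta_power_self n by simp
    have "q ^ m = y ^ (t * m) / zeta n ^ (k * m)"
      unfolding q_def power_mult_distrib power_inverse power_mult[symmetric] by (simp add: divide_inverse)
    then show "q ^ m \<noteq> 1" using ne zeta_nonzero by simp
  qed
  finally show ?thesis .
qed

text \<open>If both factors were nonzero, \<open>t\<close> would be congruent to \<open>k\<close>
  and to \<open>- k'\<close> modulo \<open>d\<close>, so \<open>d\<close> would divide
  \<open>k + k'\<close>.\<close>

lemma coset_character_fourier_disjoint: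
  assumes n: "n = d * m" "n > 0" and k: "k < m" "k' < m" "0 < k + k'" "k + k' < d" and t: "t < n"
  shows "fourier (coset_character n m k) $ t * inv_fourier (coset_character n m k') $ t = 0"
proof (rule ccontr)
  assume "\<not> ?thesis"
  then have ne: "(\<Sum>s<n. coset_character n m k $ s * zeta n ^ (s * t)) \<noteq> 0"
    "(\<Sum>s<n. coset_character n m k' $ s * inverse (zeta n) ^ (s * t)) \<noteq> 0"
    using fourier_index[OF coset_character_carrier t] inv_fourier_index[OF coset_character_carrier t]
    by auto
  have "zeta n ^ (t * m) = zeta n ^ (k * m)"
    using coset_character_sum_eq_0[OF n k(1)] zeta_power_self[OF n(2)] ne(1) by blast
  moreover have "inverse (zeta n) ^ (t * m) = zeta n ^ (k' * m)"
    using coset_character_sum_eq_0[OF n k(2), of "inverse (zeta n)"] zeta_power_self[OF n(2)] ne(2)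
    by (auto simp: power_inverse)
  ultimately have "zeta n ^ ((k + k') * m) = zeta n ^ (t * m) * inverse (zeta n) ^ (t * m)"
    by (simp add: power_add distrib_right)
  also have "\<dots> = 1" using zeta_nonzero by (simp add: power_inverse)
  finally have "n dvd (k + k') * m" by (rule zeta_power_eq_1_imp_dvd[OF n(2)])
  then have "d dvd k + k'" using n by simp
  then show False using k by (auto dest: dvd_imp_le)
qed

lemma exists_mutually_disjoint_family:
  assumes "n > 0" "d dvd n" "d * d < 2 * n"
  shows "\<exists>u :: nat \<Rightarrow> complex vec.
    (\<forall>k \<le> d div 2. u k \<in> carrier_vec n \<and> u k \<noteq> 0\<^sub>v n) \<and>
    (\<forall>k \<le> d div 2. \<forall>k' \<le> d div 2. k \<noteq> k' \<longrightarrow>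
       (\<forall>i<n. u k $ i * u k' $ i = 0 \<and> fourier (u k) $ i * inv_fourier (u k') $ i = 0))"
proof -
  obtain m where n: "n = d * m" using assms(2) by blast
  have "d * d < d * (2 * m)" using assms(3) n by simp
  then have "d < 2 * m" by simp
  then have less: "k < m" if "k \<le> d div 2" for k using that by linarith
  have "m \<le> n" using assms(1) n by simp
  have "coset_character n m k \<noteq> 0\<^sub>v n" if "k \<le> d div 2" for k
  proof
    assume "coset_character n m k = 0\<^sub>v n"
    then have "coset_character n m k $ k = 0" using less[OF that] \<open>m \<le> n\<close> by simp
    then show False
      using less[OF that] \<open>m \<le> n\<close> by (simp add: coset_character_def zeta_nonzero)
  qed
  moreover have "coset_character n m k $ i * coset_character n m k' $ i = 0" if "k \<noteq> k'" "i < n" for k k' i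
    using that by (simp add: coset_character_def)
  \<comment> \<open>Distinct indices up to \<open>d div 2\<close> have a sum strictly between 0 and
    \<open>d\<close>.\<close>
  moreover have "fourier (coset_character n m k) $ i * inv_fourier (coset_character n m k') $ i = 0"
    if "k \<le> d div 2" "k' \<le> d div 2" "k \<noteq> k'" "i < n" for k k' i
    using that less
    by (intro coset_character_fourier_disjoint[OF n assms(1)]) auto
  ultimately show ?thesis
    using coset_character_carrier by (intro exI[of _ "coset_character n m"]) blast
qed

section \<open>Small divisors of composite numbers and the equivalence\<close>

lemma composite_divisor:
  assumes "composite n"
  shows "\<exists>d. d dvd n \<and> 1 < d \<and> d * d \<le> n"
proof -
  obtain a where a: "a dvd n" "a \<noteq> 1" "a \<noteq> n" and n: "n > 1"
    using assms unfolding composite_def prime_nat_iff by blast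
  then obtain b where b: "n = a * b" by blast
  have "a \<noteq> 0" "b \<noteq> 0" using n unfolding b by (auto intro!: Nat.gr0I)
  moreover have "b \<noteq> 1" using a(3) b by simp
  ultimately have "a > 1" "b > 1" using a(2) by simp_all
  then show ?thesis
  proof (cases "a \<le> b")
    case True
    then show ?thesis using \<open>a > 1\<close> b by (intro exI[of _ a]) auto
  next
    case False
    then show ?thesis using \<open>b > 1\<close> b by (intro exI[of _ b]) auto
  qed
qed

theorem theorem1:
  fixes n :: nat
  assumes "n > 0"
  shows "((\<exists>u \<in> carrier_vec n. \<exists>v \<in> carrier_vec n. u \<noteq> 0\<^sub>v n \<and> v \<noteq> 0\<^sub>v n \<and>
             (\<forall>i<n. u $ i * v $ i = 0 \<and> fourier u $ i * inv_fourier v $ i = 0))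
           \<longleftrightarrow> composite n)
         \<and>
         (\<forall>d::nat. d dvd n \<longrightarrow> 1 < d \<longrightarrow> real d < sqrt (2 * real n) \<longrightarrow>
           (\<exists>u :: nat \<Rightarrow> complex vec.
              (\<forall>k \<le> d div 2. u k \<in> carrier_vec n \<and> u k \<noteq> 0\<^sub>v n) \<and>
              (\<forall>k \<le> d div 2. \<forall>k' \<le> d div 2. k \<noteq> k' \<longrightarrow>
                 (\<forall>i<n. u k $ i * u k' $ i = 0 \<and>
                        fourier (u k) $ i * inv_fourier (u k') $ i = 0))))"
proof (intro conjI allI impI iffI)
  assume "\<exists>u \<in> carrier_vec n. \<exists>v \<in> carrier_vec n. u \<noteq> 0\<^sub>v n \<and> v \<noteq> 0\<^sub>v n \<and>
    (\<forall>i<n. u $ i * v $ i = 0 \<and> fourier u $ i * inv_fourier v $ i = 0)"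
  then obtain u v where uv: "u \<in> carrier_vec n" "u \<noteq> 0\<^sub>v n" "v \<in> carrier_vec n" "v \<noteq> 0\<^sub>v n"
    "\<And>i. i < n \<Longrightarrow> u $ i * v $ i = 0" "\<And>i. i < n \<Longrightarrow> fourier u $ i * inv_fourier v $ i = 0"
    by blast
  have "\<not> prime n" using prime_no_pair uv by blast
  \<comment> \<open>For \<open>n = 1\<close> the only entries of \<open>u\<close> and
    \<open>v\<close> are nonzero, yet their product is 0.\<close>
  moreover have "n \<noteq> 1"
  proof
    assume "n = 1"
    then have "u $ 0 \<noteq> 0" "v $ 0 \<noteq> 0" using uv(1-4) by (auto simp: vec_eq_iff)
    then show False using uv(5)[of 0] \<open>n = 1\<close> by simp
  qed
  ultimately show "composite n" using assms by (simp add: composite_def)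
next
  assume "composite n"
  then obtain d where d: "d dvd n" "1 < d" "d * d \<le> n" using composite_divisor by blast
  then obtain u where u: "\<forall>k \<le> d div 2. u k \<in> carrier_vec n \<and> u k \<noteq> 0\<^sub>v n"
    "\<forall>k \<le> d div 2. \<forall>k' \<le> d div 2. k \<noteq> k' \<longrightarrow>
       (\<forall>i<n. u k $ i * u k' $ i = 0 \<and> fourier (u k) $ i * inv_fourier (u k') $ i = 0)"
    using exists_mutually_disjoint_family[OF assms d(1)] assms by auto
  \<comment> \<open>Since \<open>d \<ge> 2\<close>, the indices 0 and 1 both belong to the family
    and give the pair.\<close>
  have le: "0 \<le> d div 2" "1 \<le> d div 2" using d(2) by simp_all
  have "u 0 \<in> carrier_vec n" "u 1 \<in> carrier_vec n" "u 0 \<noteq> 0\<^sub>v n" "u 1 \<noteq> 0\<^sub>v n"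
    using u(1) le by blast+
  moreover have "\<forall>i<n. u 0 $ i * u 1 $ i = 0 \<and> fourier (u 0) $ i * inv_fourier (u 1) $ i = 0"
    using u(2) le zero_neq_one by blast
  ultimately show "\<exists>u \<in> carrier_vec n. \<exists>v \<in> carrier_vec n. u \<noteq> 0\<^sub>v n \<and> v \<noteq> 0\<^sub>v n \<and>
    (\<forall>i<n. u $ i * v $ i = 0 \<and> fourier u $ i * inv_fourier v $ i = 0)"
    by blast
next
  fix d :: nat
  assume d: "d dvd n" "1 < d" "real d < sqrt (2 * real n)"
  have "(real d)\<^sup>2 < (sqrt (2 * real n))\<^sup>2" using d(3) by (intro power_strict_mono) auto
  then have "real (d * d) < real (2 * n)" by (simp add: power2_eq_square)
  then have "d * d < 2 * n" by (simp only: of_nat_less_iff)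
  then show "\<exists>u :: nat \<Rightarrow> complex vec.
    (\<forall>k \<le> d div 2. u k \<in> carrier_vec n \<and> u k \<noteq> 0\<^sub>v n) \<and>
    (\<forall>k \<le> d div 2. \<forall>k' \<le> d div 2. k \<noteq> k' \<longrightarrow>
       (\<forall>i<n. u k $ i * u k' $ i = 0 \<and> fourier (u k) $ i * inv_fourier (u k') $ i = 0))"
    by (rule exists_mutually_disjoint_family[OF assms d(1)])
qed

end
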